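(* Let $A_1,\ldots,A_n$ be positive semidefinite $m\times m$ matrices and let $B$ be a complex Hermitian $m\times m$ matrix. Then the polynomial $$f(z_1,\ldots,z_n)=\det\left(\sum_{i=1}^n z_iA_i+B\right)$$ is either real stable or identically zero.
   Context: A polynomial $f\in\mathbb{C}[z_1,\ldots,z_n]$ is real stable if it has real coefficients and $f(z_1,\ldots,z_n)\neq 0$ whenever $\operatorname{Im}(z_j)>0$ for all $1\le j\le n$. Positive semidefinite matrices are complex Hermitian matrices with nonnegative eigenvalues. *)

theory Defs
  imports
    "HOL-Library.Poly_Mapping"
    "Jordan_Normal_Form.Schur_Decomposition"
begin

text \<open>Complex polynomials in the variables $z_0, z_1, \ldots$: finitely supported maps from
  exponent vectors to coefficients, multiplied by convolution.\<close>

type_synonym cmpoly = "(nat \<Rightarrow>\<^sub>0 nat) \<Rightarrow>\<^sub>0 complex"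

definition mconst :: "complex \<Rightarrow> cmpoly" where
  "mconst c = Poly_Mapping.single 0 c"

definition mvar :: "nat \<Rightarrow> cmpoly" where
  "mvar i = Poly_Mapping.single (Poly_Mapping.single i 1) 1"

text \<open>The ring $C[z_0,\ldots,z_{n-1}]$.\<close>

definition mpolys :: "nat \<Rightarrow> cmpoly set" where
  "mpolys n = {f. \<forall>\<alpha>\<in>Poly_Mapping.keys f. Poly_Mapping.keys \<alpha> \<subseteq> {..<n}}"

definition eval_mpoly :: "cmpoly \<Rightarrow> (nat \<Rightarrow> complex) \<Rightarrow> complex" where
  "eval_mpoly f z = (\<Sum>\<alpha>\<in>Poly_Mapping.keys f. Poly_Mapping.lookup f \<alpha> *
     (\<Prod>i\<in>Poly_Mapping.keys \<alpha>. z i ^ Poly_Mapping.lookup \<alpha> i))"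

text \<open>Only the values \<open>z i\<close> with \<open>i < n\<close> matter, because of membership in \<open>mpolys n\<close>.\<close>

definition real_stable :: "nat \<Rightarrow> cmpoly \<Rightarrow> bool" where
  "real_stable n f \<longleftrightarrow> f \<in> mpolys n \<and> (\<forall>\<alpha>. Poly_Mapping.lookup f \<alpha> \<in> \<real>) \<and>
     (\<forall>z. (\<forall>j<n. Im (z j) > 0) \<longrightarrow> eval_mpoly f z \<noteq> 0)"

definition hermitian_mat :: "nat \<Rightarrow> complex mat \<Rightarrow> bool" where
  "hermitian_mat m A \<longleftrightarrow> A \<in> carrier_mat m m \<and> mat_adjoint A = A"

text \<open>In the order on the complex numbers, \<open>0 \<le> k\<close> means that \<open>k\<close> is real and nonnegative.\<close>

definition psd_mat :: "nat \<Rightarrow> complex mat \<Rightarrow> bool" where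
  "psd_mat m A \<longleftrightarrow> hermitian_mat m A \<and> (\<forall>k. eigenvalue A k \<longrightarrow> 0 \<le> k)"

text \<open>The matrix $\sum_i z_i A_i + B$ over the polynomial ring. The sum is taken in the abelian
  group of \<open>m\<close> by \<open>m\<close> matrices, since the type of matrices of all sizes has no zero.\<close>

definition pencil :: "nat \<Rightarrow> nat \<Rightarrow> (nat \<Rightarrow> complex mat) \<Rightarrow> complex mat \<Rightarrow> cmpoly mat" where
  "pencil m n A B =
     finsum (module_mat TYPE(cmpoly) m m) (\<lambda>i. mvar i \<cdot>\<^sub>m map_mat mconst (A i)) {..<n}
     + map_mat mconst B"

end

theory Submission
  imports Defs
begin

text \<open>Suppose the determinant vanishes at a point \<open>z\<close> of the open upper half space and let
  \<open>v \<noteq> 0\<close> be in the kernel of \<open>M = \<Sum>\<^sub>k z\<^sub>k A\<^sub>k + B\<close>. The imaginary part of \<open>v\<^sup>* M v = 0\<close> is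
  \<open>\<Sum>\<^sub>k Im z\<^sub>k \<cdot> v\<^sup>* A\<^sub>k v\<close>, a sum of nonnegative terms, so \<open>v\<^sup>* A\<^sub>k v = 0\<close> and therefore
  \<open>A\<^sub>k v = 0\<close> for all \<open>k\<close>; then also \<open>B v = 0\<close>. So the constant vector \<open>v\<close> is in the kernel of the
  pencil over the polynomial ring, and the adjugate shows that the determinant is the zero polynomial.
  The coefficients are real because conjugating them transposes the pencil.\<close>

section \<open>Norms and Hermitian forms in coordinates\<close>

text \<open>Vectors and matrices are functions here, of which only the indices below \<open>m\<close> matter.\<close>

definition nsq :: "nat \<Rightarrow> (nat \<Rightarrow> complex) \<Rightarrow> real" where
  "nsq m v = (\<Sum>i<m. (cmod (v i))\<^sup>2)"

text \<open>The general coefficient type lets one definition serve both for complex matrices and for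
  the pencil over the polynomial ring.\<close>

definition app :: "nat \<Rightarrow> (nat \<Rightarrow> nat \<Rightarrow> 'a::comm_semiring_0) \<Rightarrow> (nat \<Rightarrow> 'a) \<Rightarrow> nat \<Rightarrow> 'a" where
  "app m a v i = (\<Sum>j<m. a i j * v j)"

definition sesq :: "nat \<Rightarrow> (nat \<Rightarrow> complex) \<Rightarrow> (nat \<Rightarrow> complex) \<Rightarrow> complex" where
  "sesq m u v = (\<Sum>i<m. cnj (u i) * v i)"

definition herm :: "nat \<Rightarrow> (nat \<Rightarrow> nat \<Rightarrow> complex) \<Rightarrow> bool" where
  "herm m a \<longleftrightarrow> (\<forall>i<m. \<forall>j<m. cnj (a i j) = a j i)"

text \<open>Taking the real part gives an ordered value for every matrix; for Hermitian
  \<open>a\<close> nothing is lost, by \<open>sesq_app_self_real\<close>.\<close>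

definition qform :: "nat \<Rightarrow> (nat \<Rightarrow> nat \<Rightarrow> complex) \<Rightarrow> (nat \<Rightarrow> complex) \<Rightarrow> real" where
  "qform m a v = Re (sesq m v (app m a v))"

lemma nsq_nonneg: "0 \<le> nsq m v"
  by (simp add: nsq_def sum_nonneg)

lemma nsq_eq_0_iff: "nsq m v = 0 \<longleftrightarrow> (\<forall>i<m. v i = 0)"
  by (auto simp: nsq_def sum_nonneg_eq_0_iff)

lemma sesq_self: "sesq m v v = of_real (nsq m v)"
  by (simp add: sesq_def nsq_def complex_norm_square mult.commute del: of_real_power)

lemma cnj_sesq: "cnj (sesq m u v) = sesq m v u"
  by (simp add: sesq_def mult.commute)

text \<open>Swapping the two sums and reading \<open>a i j\<close> as the conjugate of
  \<open>a j i\<close> moves the matrix to the other argument.\<close>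

lemma sesq_app:
  assumes "herm m a"
  shows "sesq m u (app m a v) = sesq m (app m a u) v"
proof -
  have "sesq m u (app m a v) = (\<Sum>i<m. \<Sum>j<m. cnj (u i) * (a i j * v j))"
    by (simp add: sesq_def app_def sum_distrib_left)
  also have "\<dots> = (\<Sum>j<m. \<Sum>i<m. cnj (u i) * (a i j * v j))"
    by (rule sum.swap)
  also have "\<dots> = (\<Sum>j<m. \<Sum>i<m. cnj (a j i * u i) * v j)"
    using assms by (intro sum.cong refl) (auto simp: herm_def)
  also have "\<dots> = sesq m (app m a u) v"
    by (simp add: sesq_def app_def sum_distrib_right)
  finally show ?thesis .
qed

lemma sesq_app_self_real:
  assumes "herm m a"
  shows "sesq m v (app m a v) = of_real (qform m a v)"
proof -
  have "cnj (sesq m v (app m a v)) = sesq m v (app m a v)"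
    using sesq_app[OF assms, of v v] by (simp add: cnj_sesq)
  then have "sesq m v (app m a v) \<in> \<real>"
    by (simp add: Reals_cnj_iff)
  then show ?thesis
    by (simp add: qform_def)
qed

lemma nsq_app_le: "\<exists>K>0. \<forall>v. nsq m (app m a v) \<le> K * nsq m v"
proof -
  \<comment> \<open>A crude operator bound: each \<open>cmod (v j)\<close> is at most the norm of
    \<open>v\<close>. The summand 1 keeps \<open>K\<close> positive when the matrix is zero.\<close>
  define K where "K = 1 + (\<Sum>i<m. (\<Sum>j<m. cmod (a i j))\<^sup>2)"
  have "0 \<le> (\<Sum>i<m. (\<Sum>j<m. cmod (a i j))\<^sup>2)"
    by (simp add: sum_nonneg)
  then have "K > 0"
    by (simp add: K_def)
  moreover have "nsq m (app m a v) \<le> K * nsq m v" for v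
  proof -
    let ?r = "sqrt (nsq m v)"
    have v: "cmod (v j) \<le> ?r" if "j < m" for j
    proof (rule real_le_rsqrt)
      show "(cmod (v j))\<^sup>2 \<le> nsq m v"
        unfolding nsq_def using that by (intro member_le_sum) auto
    qed
    have "(cmod (app m a v i))\<^sup>2 \<le> (\<Sum>j<m. cmod (a i j))\<^sup>2 * nsq m v" for i
    proof -
      have "cmod (app m a v i) \<le> (\<Sum>j<m. cmod (a i j * v j))"
        unfolding app_def by (rule norm_sum)
      also have "\<dots> \<le> (\<Sum>j<m. cmod (a i j) * ?r)"
        by (intro sum_mono) (auto simp: norm_mult intro!: mult_left_mono v)
      also have "\<dots> = (\<Sum>j<m. cmod (a i j)) * ?r"
        by (simp add: sum_distrib_right)
      finally have "(cmod (app m a v i))\<^sup>2 \<le> ((\<Sum>j<m. cmod (a i j)) * ?r)\<^sup>2"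
        by (intro power_mono) auto
      then show ?thesis
        by (simp add: power_mult_distrib nsq_nonneg)
    qed
    then have "nsq m (app m a v) \<le> (\<Sum>i<m. (\<Sum>j<m. cmod (a i j))\<^sup>2 * nsq m v)"
      unfolding nsq_def[of m "app m a v"] by (intro sum_mono) auto
    also have "\<dots> \<le> K * nsq m v"
      using nsq_nonneg[of m v] by (simp add: K_def sum_distrib_right distrib_right)
    finally show ?thesis .
  qed
  ultimately show ?thesis
    by blast
qed

text \<open>For real \<open>t\<close> the two cross terms are conjugate to each other, hence add up
  to twice a real part.\<close>

lemma qform_add:
  assumes "herm m a"
  shows "qform m a (\<lambda>i. v i + of_real t * w i) =
    qform m a v + 2 * t * Re (sesq m w (app m a v)) + t\<^sup>2 * qform m a w"
proof -
  have "app m a (\<lambda>i. v i + of_real t * w i) = (\<lambda>i. app m a v i + of_real t * app m a w i)"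
    by (simp add: app_def fun_eq_iff distrib_left sum.distrib sum_distrib_left mult_ac)
  moreover have "sesq m (\<lambda>i. v i + of_real t * w i) (\<lambda>i. x i + of_real t * y i) =
     sesq m v x + of_real t * sesq m w x + of_real t * sesq m v y + of_real (t\<^sup>2) * sesq m w y" for x y
    by (simp add: sesq_def distrib_left distrib_right sum.distrib sum_distrib_left mult_ac power2_eq_square)
  moreover have "sesq m v (app m a w) = cnj (sesq m w (app m a v))"
    using sesq_app[OF assms, of v w] by (simp add: cnj_sesq)
  ultimately show ?thesis
    by (simp add: qform_def)
qed

lemma abs_qform_le: "\<exists>K>0. \<forall>v. \<bar>qform m a v\<bar> \<le> K * nsq m v"
proof -
  obtain K where K: "K > 0" "\<And>v. nsq m (app m a v) \<le> K * nsq m v"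
    using nsq_app_le by metis
  have "\<bar>qform m a v\<bar> \<le> (K + 1) * nsq m v" for v
  proof -
    have "\<bar>qform m a v\<bar> \<le> (\<Sum>i<m. cmod (cnj (v i) * app m a v i))"
      unfolding qform_def sesq_def by (rule order_trans[OF abs_Re_le_cmod norm_sum])
    \<comment> \<open>The bound \<open>2 * x * y \<le> x^2 + y^2\<close> separates the two factors,
      so that \<open>nsq_app_le\<close> applies.\<close>
    also have "\<dots> \<le> (\<Sum>i<m. (cmod (app m a v i))\<^sup>2 + (cmod (v i))\<^sup>2)"
    proof (intro sum_mono)
      fix i
      have "2 * (cmod (v i) * cmod (app m a v i)) \<le> (cmod (v i))\<^sup>2 + (cmod (app m a v i))\<^sup>2"
        using sum_squares_bound[of "cmod (v i)" "cmod (app m a v i)"] by (simp add: mult_ac)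
      moreover have "0 \<le> cmod (v i) * cmod (app m a v i)"
        by simp
      ultimately show "cmod (cnj (v i) * app m a v i) \<le> (cmod (app m a v i))\<^sup>2 + (cmod (v i))\<^sup>2"
        unfolding norm_mult complex_mod_cnj by linarith
    qed
    also have "\<dots> = nsq m (app m a v) + nsq m v"
      by (simp add: nsq_def sum.distrib)
    also have "\<dots> \<le> (K + 1) * nsq m v"
      using K(2)[of v] by (simp add: distrib_right)
    finally show ?thesis .
  qed
  then show ?thesis
    using K(1) by (intro exI[of _ "K + 1"]) auto
qed

text \<open>Evaluate the nonnegative form at \<open>v - a v / K\<close>, where \<open>K\<close> bounds the form.\<close>

lemma nsq_app_le_qform:
  assumes "herm m a" and nonneg: "\<And>v. 0 \<le> qform m a v"
  shows "\<exists>K>0. \<forall>v. nsq m (app m a v) \<le> K * qform m a v"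
proof -
  obtain K where K: "K > 0" "\<And>v. \<bar>qform m a v\<bar> \<le> K * nsq m v"
    using abs_qform_le by metis
  have "nsq m (app m a v) \<le> K * qform m a v" for v
  proof -
    let ?w = "app m a v"
    have "0 \<le> qform m a (\<lambda>i. v i + of_real (- 1 / K) * ?w i)"
      by (rule nonneg)
    also have "\<dots> = qform m a v - 2 / K * nsq m ?w + (1 / K)\<^sup>2 * qform m a ?w"
      unfolding qform_add[OF assms(1)] sesq_self by (simp add: power2_eq_square)
    \<comment> \<open>With \<open>N = nsq m ?w\<close>, the choice \<open>t = - 1 / K\<close>
      minimises \<open>2 * t * N + t^2 * K * N\<close>; the minimum is
      \<open>- N / K\<close>.\<close>
    also have "\<dots> \<le> qform m a v - 2 / K * nsq m ?w + (1 / K)\<^sup>2 * (K * nsq m ?w)"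
      using K(2)[of ?w] by (intro add_left_mono mult_left_mono) auto
    also have "\<dots> = qform m a v - nsq m ?w / K"
      using K(1) by (simp add: field_simps power2_eq_square)
    finally show ?thesis
      using K(1) by (simp add: field_simps)
  qed
  then show ?thesis
    using K(1) by blast
qed

section \<open>Kernels, adjugates and lower bounds for matrices\<close>

abbreviation entries :: "'a mat \<Rightarrow> nat \<Rightarrow> nat \<Rightarrow> 'a" where
  "entries X \<equiv> \<lambda>i j. X $$ (i, j)"

lemma index_mult_mat_vec_app:
  assumes "X \<in> carrier_mat m m" "v \<in> carrier_vec m" "i < m"
  shows "(X *\<^sub>v v) $ i = app m (entries X) (($) v) i"
  using assms by (auto simp: app_def scalar_prod_def lessThan_atLeast0 intro!: sum.cong)

lemma singular_mat_app:
  fixes X :: "'a::field mat"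
  assumes X: "X \<in> carrier_mat m m" and "det X = 0"
  obtains v where "v \<in> carrier_vec m" "v \<noteq> 0\<^sub>v m" "\<And>i. i < m \<Longrightarrow> app m (entries X) (($) v) i = 0"
proof -
  obtain v where v: "v \<in> carrier_vec m" "v \<noteq> 0\<^sub>v m" "X *\<^sub>v v = 0\<^sub>v m"
    using assms det_0_iff_vec_prod_zero_field[OF X] by blast
  have "app m (entries X) (($) v) i = 0" if "i < m" for i
    using index_mult_mat_vec_app[OF X v(1) that] v(3) that by simp
  then show ?thesis
    using v that by blast
qed

text \<open>The adjugate identity needs no division, so it holds over the polynomial ring as well as
  over the complex numbers.\<close>

lemma adj_mat_mult_mat_vec:
  assumes P: "P \<in> carrier_mat m m" and w: "w \<in> carrier_vec m"
  shows "adj_mat P *\<^sub>v (P *\<^sub>v w) = det P \<cdot>\<^sub>v w"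
proof -
  have "adj_mat P *\<^sub>v (P *\<^sub>v w) = (det P \<cdot>\<^sub>m 1\<^sub>m m) *\<^sub>v w"
    using adj_mat[OF P] P w by (simp flip: assoc_mult_mat_vec)
  also have "\<dots> = det P \<cdot>\<^sub>v w"
  proof (rule eq_vecI)
    fix i assume "i < dim_vec (det P \<cdot>\<^sub>v w)"
    then have "i < m"
      using w by simp
    then show "(det P \<cdot>\<^sub>m 1\<^sub>m m *\<^sub>v w) $ i = (det P \<cdot>\<^sub>v w) $ i"
      using w by (simp add: scalar_prod_def if_distrib if_distribR sum.delta cong: if_cong)
  qed (use w in auto)
  finally show ?thesis .
qed

text \<open>The adjugate undoes \<open>X\<close> up to the nonzero factor \<open>det X\<close>, and
  it is itself bounded by \<open>nsq_app_le\<close>.\<close>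

lemma nsq_le_nsq_app:
  assumes X: "X \<in> carrier_mat m m" and det: "det X \<noteq> 0"
  shows "\<exists>K>0. \<forall>v. nsq m v \<le> K * nsq m (app m (entries X) v)"
proof -
  let ?d = "(cmod (det X))\<^sup>2" and ?R = "adj_mat X"
  obtain K where K: "K > 0" "\<And>v. nsq m (app m (entries ?R) v) \<le> K * nsq m v"
    using nsq_app_le by metis
  note R = adj_mat(1)[OF X]
  have "nsq m v \<le> K / ?d * nsq m (app m (entries X) v)" for v
  proof -
    let ?v = "vec m v"
    have Xv: "X *\<^sub>v ?v \<in> carrier_vec m"
      using X by (intro mult_mat_vec_carrier) auto
    have "app m (entries ?R) (app m (entries X) v) i = det X * v i" if "i < m" for i
    proof -
      have "?R *\<^sub>v (X *\<^sub>v ?v) = det X \<cdot>\<^sub>v ?v"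
        by (rule adj_mat_mult_mat_vec[OF X]) simp
      then have "app m (entries ?R) (($) (X *\<^sub>v ?v)) i = det X * v i"
        using index_mult_mat_vec_app[OF R Xv that] that by simp
      moreover have "(X *\<^sub>v ?v) $ j = app m (entries X) v j" if "j < m" for j
        using index_mult_mat_vec_app[OF X _ that, of ?v] by (simp add: app_def)
      ultimately show ?thesis
        by (simp add: app_def)
    qed
    then have "?d * nsq m v = nsq m (app m (entries ?R) (app m (entries X) v))"
      by (simp add: nsq_def norm_mult power_mult_distrib sum_distrib_left)
    also have "\<dots> \<le> K * nsq m (app m (entries X) v)"
      by (rule K)
    finally show ?thesis
      using det by (simp add: field_simps)
  qed
  moreover have "K / ?d > 0"
    using K(1) det by simp
  ultimately show ?thesis
    by blast
qed

section \<open>Positive semidefinite matrices and the Rayleigh quotient\<close>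

lemma hermitian_mat_herm:
  assumes "hermitian_mat m X"
  shows "herm m (entries X)"
proof -
  have X: "X \<in> carrier_mat m m" and adj: "mat_adjoint X = X"
    using assms by (auto simp: hermitian_mat_def)
  have "cnj (X $$ (i, j)) = X $$ (j, i)" if "i < m" "j < m" for i j
  proof -
    have "cnj (X $$ (i, j)) = mat_adjoint X $$ (j, i)"
      using X that by (simp add: mat_adjoint_def mat_of_rows_def)
    then show ?thesis
      by (simp add: adj)
  qed
  then show ?thesis
    by (simp add: herm_def)
qed

text \<open>The infimum \<open>l\<close> of the Rayleigh quotient is an eigenvalue: otherwise \<open>X - l\<close> is invertible with
  nonnegative form, so the form is bounded below by a positive multiple of \<open>nsq\<close>, contradicting the
  choice of \<open>l\<close>. This avoids both compactness and the spectral theorem.\<close>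

lemma psd_mat_qform_nonneg:
  assumes "psd_mat m X"
  shows "0 \<le> qform m (entries X) v"
proof (rule ccontr)
  assume neg: "\<not> 0 \<le> qform m (entries X) v"
  have X: "X \<in> carrier_mat m m" and herm: "herm m (entries X)"
    using assms hermitian_mat_herm by (auto simp: psd_mat_def hermitian_mat_def)
  obtain K where K: "K > 0" "\<And>v. \<bar>qform m (entries X) v\<bar> \<le> K * nsq m v"
    using abs_qform_le by metis
  define S where "S = {qform m (entries X) v / nsq m v | v. nsq m v > 0}"
  define l where "l = Inf S"
  \<comment> \<open>Vectors with \<open>nsq\<close> zero contribute no quotient to \<open>S\<close>;
    the bound by \<open>K\<close> shows that their form vanishes.\<close>
  have qform0: "qform m (entries X) u = 0" if "nsq m u = 0" for u
    using K(2)[of u] that by simp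
  have bdd: "bdd_below S"
  proof (rule bdd_belowI)
    fix x assume "x \<in> S"
    then obtain u where u: "nsq m u > 0" "x = qform m (entries X) u / nsq m u"
      by (auto simp: S_def)
    then show "- K \<le> x"
      using K(2)[of u] by (simp add: pos_le_divide_eq)
  qed
  \<comment> \<open>The vector with negative form makes \<open>S\<close> nonempty and forces its
    infimum \<open>l\<close> below zero.\<close>
  have "nsq m v > 0"
    using neg qform0[of v] nsq_nonneg[of m v] by fastforce
  then have vS: "qform m (entries X) v / nsq m v \<in> S"
    by (auto simp: S_def)
  then have "l \<le> qform m (entries X) v / nsq m v"
    unfolding l_def using bdd by (rule cInf_lower)
  also have "\<dots> < 0"
    using neg \<open>nsq m v > 0\<close> by (simp add: field_simps)
  finally have "l < 0" .
  define C where "C = X + (- of_real l) \<cdot>\<^sub>m 1\<^sub>m m"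
  have C: "C \<in> carrier_mat m m"
    using X by (simp add: C_def)
  have C_entries: "C $$ (i, j) = X $$ (i, j) - (if i = j then of_real l else 0)" if "i < m" "j < m" for i j
    using X that by (simp add: C_def)
  have hermC: "herm m (entries C)"
    using herm by (auto simp: herm_def C_entries)
  have appC: "app m (entries C) u i = app m (entries X) u i - of_real l * u i" if "i < m" for u i
  proof -
    have "app m (entries C) u i = (\<Sum>j<m. X $$ (i, j) * u j - (if j = i then of_real l * u j else 0))"
      unfolding app_def using that by (intro sum.cong refl) (simp add: C_entries left_diff_distrib)
    then show ?thesis
      using that by (simp add: app_def sum_subtractf)
  qed
  have qC: "qform m (entries C) u = qform m (entries X) u - l * nsq m u" for u
  proof -
    have "sesq m u (app m (entries C) u) = sesq m u (app m (entries X) u) - of_real l * sesq m u u"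
      by (simp add: sesq_def appC right_diff_distrib sum_subtractf sum_distrib_left mult_ac)
    then show ?thesis
      by (simp add: qform_def sesq_self)
  qed
  have "0 \<le> qform m (entries C) u" for u
  proof (cases "nsq m u = 0")
    case True
    then show ?thesis
      by (simp add: qC qform0)
  next
    case False
    then have pos: "nsq m u > 0"
      using nsq_nonneg[of m u] by simp
    then have "l \<le> qform m (entries X) u / nsq m u"
      unfolding l_def using bdd by (intro cInf_lower) (auto simp: S_def)
    then show ?thesis
      using pos by (simp add: qC field_simps)
  qed
  then obtain K1 where K1: "K1 > 0" "\<And>u. nsq m (app m (entries C) u) \<le> K1 * qform m (entries C) u"
    using nsq_app_le_qform[OF hermC] by metis
  show False
  proof (cases "det C = 0")
    case True
    then obtain u where u: "u \<in> carrier_vec m" "u \<noteq> 0\<^sub>v m"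
        "\<And>i. i < m \<Longrightarrow> app m (entries C) (($) u) i = 0"
      using singular_mat_app[OF C] by blast
    \<comment> \<open>A kernel vector of \<open>C\<close> is an eigenvector of \<open>X\<close> for
      \<open>l\<close>, and \<open>l < 0\<close> contradicts the hypothesis on eigenvalues.\<close>
    have "X *\<^sub>v u = of_real l \<cdot>\<^sub>v u"
    proof (rule eq_vecI)
      fix i assume "i < dim_vec (complex_of_real l \<cdot>\<^sub>v u)"
      then have i: "i < m"
        using u by simp
      then show "(X *\<^sub>v u) $ i = (complex_of_real l \<cdot>\<^sub>v u) $ i"
        using u X i appC[OF i, of "($) u"] by (simp add: index_mult_mat_vec_app del: index_mult_mat_vec)
    qed (use X u in auto)
    then have "eigenvalue X (of_real l)"
      using u X by (auto simp: eigenvalue_def eigenvector_def)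
    then have "0 \<le> complex_of_real l"
      using assms by (auto simp: psd_mat_def)
    then show False
      using \<open>l < 0\<close> by (simp add: less_eq_complex_def)
  next
    case False
    then obtain K2 where K2: "K2 > 0" "\<And>u. nsq m u \<le> K2 * nsq m (app m (entries C) u)"
      using nsq_le_nsq_app[OF C] by metis
    \<comment> \<open>Chaining the bounds \<open>K2\<close> and \<open>K1\<close> gives
      \<open>nsq m u \<le> K2 * K1 * qform m (entries C) u\<close>, so every quotient exceeds
      \<open>l\<close> by at least \<open>1 / (K2 * K1)\<close>.\<close>
    have "l + 1 / (K2 * K1) \<le> Inf S"
    proof (rule cInf_greatest)
      show "S \<noteq> {}"
        using vS by auto
      fix x assume "x \<in> S"
      then obtain u where u: "nsq m u > 0" "x = qform m (entries X) u / nsq m u"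
        by (auto simp: S_def)
      have "nsq m u \<le> K2 * nsq m (app m (entries C) u)"
        by (rule K2)
      also have "\<dots> \<le> K2 * (K1 * (qform m (entries X) u - l * nsq m u))"
        using K1(2)[of u] K2(1) by (intro mult_left_mono) (auto simp: qC)
      finally have "nsq m u / (K2 * K1) \<le> qform m (entries X) u - l * nsq m u"
        using K1 K2 by (simp add: field_simps)
      then have "(l + 1 / (K2 * K1)) * nsq m u \<le> qform m (entries X) u"
        by (simp add: algebra_simps)
      then show "l + 1 / (K2 * K1) \<le> x"
        using u by (simp add: pos_le_divide_eq)
    qed
    moreover have "0 < 1 / (K2 * K1)"
      using K1 K2 by simp
    ultimately show False
      by (simp add: l_def)
  qed
qed

text \<open>By \<open>nsq_app_le_qform\<close> the squared norm of the image is at most a multiple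
  of the form, so it vanishes with it.\<close>

lemma psd_mat_app_eq_0:
  assumes "psd_mat m X" "qform m (entries X) v = 0" "i < m"
  shows "app m (entries X) v i = 0"
proof -
  have "herm m (entries X)"
    using assms(1) hermitian_mat_herm by (auto simp: psd_mat_def)
  then obtain K where "nsq m (app m (entries X) v) \<le> K * qform m (entries X) v"
    using nsq_app_le_qform psd_mat_qform_nonneg[OF assms(1)] by metis
  then show ?thesis
    using assms(2,3) nsq_nonneg[of m "app m (entries X) v"] nsq_eq_0_iff[of m "app m (entries X) v"]
    by auto
qed

section \<open>Evaluation and conjugation of polynomials\<close>

text \<open>Updating at a fresh key amounts to adding a single term. Identities between additive
  maps thus reduce to single terms.\<close>

lemma poly_mapping_add_induct [case_names zero single add]:
  fixes f :: "'a \<Rightarrow>\<^sub>0 'b::comm_monoid_add"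
  assumes "P 0" "\<And>a b. P (Poly_Mapping.single a b)" "\<And>f g. P f \<Longrightarrow> P g \<Longrightarrow> P (f + g)"
  shows "P f"
proof (induction f rule: Poly_Mapping.update_induct)
  case const
  show ?case by (rule assms)
next
  case (update f a b)
  have "Poly_Mapping.update a b f = Poly_Mapping.single a b + f"
    using update by (intro poly_mapping_eqI)
      (auto simp: lookup_update lookup_add lookup_single when_def in_keys_iff)
  then show ?case
    using update assms by metis
qed

definition eval_monom :: "(nat \<Rightarrow> complex) \<Rightarrow> (nat \<Rightarrow>\<^sub>0 nat) \<Rightarrow> complex" where
  "eval_monom z \<alpha> = (\<Prod>i\<in>Poly_Mapping.keys \<alpha>. z i ^ Poly_Mapping.lookup \<alpha> i)"

text \<open>The extra factors are zeroth powers, equal to 1. Two monomials can therefore be compared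
  over a common index set.\<close>

lemma eval_monom_superset:
  assumes "finite I" "Poly_Mapping.keys \<alpha> \<subseteq> I"
  shows "eval_monom z \<alpha> = (\<Prod>i\<in>I. z i ^ Poly_Mapping.lookup \<alpha> i)"
  unfolding eval_monom_def using assms
  by (intro prod.mono_neutral_left) (auto simp: in_keys_iff)

lemma eval_monom_0 [simp]: "eval_monom z 0 = 1"
  by (simp add: eval_monom_def)

lemma eval_monom_single [simp]: "eval_monom z (Poly_Mapping.single i k) = z i ^ k"
  by (simp add: eval_monom_def)

lemma eval_monom_add: "eval_monom z (\<alpha> + \<beta>) = eval_monom z \<alpha> * eval_monom z \<beta>"
proof -
  let ?I = "Poly_Mapping.keys \<alpha> \<union> Poly_Mapping.keys \<beta>"
  have "eval_monom z (\<alpha> + \<beta>) = (\<Prod>i\<in>?I. z i ^ Poly_Mapping.lookup (\<alpha> + \<beta>) i)"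
    by (rule eval_monom_superset) (auto simp: Poly_Mapping.keys_add)
  then show ?thesis
    by (simp add: eval_monom_superset[of ?I] lookup_add power_add prod.distrib)
qed

lemma eval_mpoly_superset:
  assumes "finite I" "Poly_Mapping.keys f \<subseteq> I"
  shows "eval_mpoly f z = (\<Sum>\<alpha>\<in>I. Poly_Mapping.lookup f \<alpha> * eval_monom z \<alpha>)"
  unfolding eval_mpoly_def eval_monom_def[symmetric] using assms
  by (intro sum.mono_neutral_left) (auto simp: in_keys_iff)

lemma eval_mpoly_0: "eval_mpoly 0 z = 0"
  by (simp add: eval_mpoly_def)

lemma eval_mpoly_single: "eval_mpoly (Poly_Mapping.single \<alpha> c) z = c * eval_monom z \<alpha>"
  by (simp add: eval_mpoly_superset[of "{\<alpha>}"])

lemma eval_mpoly_add: "eval_mpoly (f + g) z = eval_mpoly f z + eval_mpoly g z"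
proof -
  let ?I = "Poly_Mapping.keys f \<union> Poly_Mapping.keys g"
  have "eval_mpoly (f + g) z = (\<Sum>\<alpha>\<in>?I. Poly_Mapping.lookup (f + g) \<alpha> * eval_monom z \<alpha>)"
    by (rule eval_mpoly_superset) (auto simp: Poly_Mapping.keys_add)
  then show ?thesis
    by (simp add: eval_mpoly_superset[of ?I] lookup_add distrib_right sum.distrib)
qed

text \<open>Both sides are additive in each factor; on single terms the convolution just adds
  exponents.\<close>

lemma eval_mpoly_mult: "eval_mpoly (f * g) z = eval_mpoly f z * eval_mpoly g z"
proof (induction f rule: poly_mapping_add_induct)
  case (single a b)
  show ?case
    by (induction g rule: poly_mapping_add_induct)
      (auto simp: eval_mpoly_0 mult_single eval_mpoly_single eval_monom_add eval_mpoly_add distrib_left)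
qed (auto simp: eval_mpoly_0 eval_mpoly_add distrib_right)

text \<open>As a ring homomorphism, evaluation at a point commutes with \<open>det\<close>.\<close>

lemma comm_ring_hom_eval_mpoly: "comm_ring_hom (\<lambda>f. eval_mpoly f z)"
proof
  show "eval_mpoly 1 z = 1"
    using eval_mpoly_single[of 0 1 z] by simp
qed (simp_all add: eval_mpoly_0 eval_mpoly_add eval_mpoly_mult)

lemma eval_mpoly_mconst [simp]: "eval_mpoly (mconst c) z = c"
  by (simp add: mconst_def eval_mpoly_single)

lemma eval_mpoly_mvar [simp]: "eval_mpoly (mvar i) z = z i"
  by (simp add: mvar_def eval_mpoly_single)

lemma comm_ring_hom_mconst: "comm_ring_hom mconst"
  by standard (simp_all add: mconst_def single_add mult_single)

text \<open>The variables stay fixed, so the fixed points are exactly the polynomials with real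
  coefficients.\<close>

definition cnj_mpoly :: "cmpoly \<Rightarrow> cmpoly" where
  "cnj_mpoly f = Poly_Mapping.map cnj f"

lemma lookup_cnj_mpoly: "Poly_Mapping.lookup (cnj_mpoly f) \<alpha> = cnj (Poly_Mapping.lookup f \<alpha>)"
  by (simp add: cnj_mpoly_def Poly_Mapping.map.rep_eq when_def)

lemma cnj_mpoly_0: "cnj_mpoly 0 = 0"
  by (intro poly_mapping_eqI) (simp add: lookup_cnj_mpoly)

lemma cnj_mpoly_single: "cnj_mpoly (Poly_Mapping.single \<alpha> c) = Poly_Mapping.single \<alpha> (cnj c)"
  by (intro poly_mapping_eqI) (simp add: lookup_cnj_mpoly lookup_single when_def)

lemma cnj_mpoly_add: "cnj_mpoly (f + g) = cnj_mpoly f + cnj_mpoly g"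
  by (intro poly_mapping_eqI) (simp add: lookup_cnj_mpoly lookup_add)

lemma cnj_mpoly_mult: "cnj_mpoly (f * g) = cnj_mpoly f * cnj_mpoly g"
proof (induction f rule: poly_mapping_add_induct)
  case (single a b)
  show ?case
    by (induction g rule: poly_mapping_add_induct)
      (auto simp: cnj_mpoly_0 mult_single cnj_mpoly_single cnj_mpoly_add distrib_left)
qed (auto simp: cnj_mpoly_0 cnj_mpoly_add distrib_right)

lemma comm_ring_hom_cnj_mpoly: "comm_ring_hom cnj_mpoly"
proof
  show "cnj_mpoly 1 = 1"
    using cnj_mpoly_single[of 0 1] by simp
qed (simp_all add: cnj_mpoly_0 cnj_mpoly_add cnj_mpoly_mult)

section \<open>Closure properties of the polynomials in \<open>n\<close> variables\<close>

lemma mpolys_0: "0 \<in> mpolys n"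
  by (simp add: mpolys_def)

lemma mpolys_1: "1 \<in> mpolys n"
  by (simp add: mpolys_def)

lemma mpolys_add: "f \<in> mpolys n \<Longrightarrow> g \<in> mpolys n \<Longrightarrow> f + g \<in> mpolys n"
  using Poly_Mapping.keys_add[of f g] by (fastforce simp: mpolys_def)

lemma mpolys_uminus: "f \<in> mpolys n \<Longrightarrow> - f \<in> mpolys n"
  by (auto simp: mpolys_def in_keys_iff)

lemma mpolys_mult:
  assumes "f \<in> mpolys n" "g \<in> mpolys n"
  shows "f * g \<in> mpolys n"
  unfolding mpolys_def
proof (intro CollectI ballI)
  fix \<gamma> assume "\<gamma> \<in> Poly_Mapping.keys (f * g)"
  then obtain \<alpha> \<beta> where "\<alpha> \<in> Poly_Mapping.keys f" "\<beta> \<in> Poly_Mapping.keys g" "\<gamma> = \<alpha> + \<beta>"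
    using keys_mult[of f g] by auto
  then show "Poly_Mapping.keys \<gamma> \<subseteq> {..<n}"
    using assms Poly_Mapping.keys_add[of \<alpha> \<beta>] by (fastforce simp: mpolys_def)
qed

lemma mpolys_mconst: "mconst c \<in> mpolys n"
  by (simp add: mpolys_def mconst_def)

lemma mpolys_mvar: "i < n \<Longrightarrow> mvar i \<in> mpolys n"
  by (simp add: mpolys_def mvar_def)

lemma mpolys_sum: "(\<And>i. i \<in> I \<Longrightarrow> f i \<in> mpolys n) \<Longrightarrow> sum f I \<in> mpolys n"
  by (induction I rule: infinite_finite_induct) (auto simp: mpolys_0 mpolys_add)

lemma mpolys_prod: "(\<And>i. i \<in> I \<Longrightarrow> f i \<in> mpolys n) \<Longrightarrow> prod f I \<in> mpolys n"
  by (induction I rule: infinite_finite_induct) (auto simp: mpolys_1 mpolys_mult)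

text \<open>The Leibniz formula builds the determinant from entries by sums, products and signs, and
  \<open>mpolys n\<close> is closed under these.\<close>

lemma mpolys_det:
  assumes P: "P \<in> carrier_mat m m"
    and entries: "\<And>i j. i < m \<Longrightarrow> j < m \<Longrightarrow> P $$ (i, j) \<in> mpolys n"
  shows "det P \<in> mpolys n"
  unfolding det_def'[OF P]
proof (intro mpolys_sum mpolys_mult mpolys_prod)
  fix p i assume "p \<in> {p. p permutes {0..<m}}" "i \<in> {0..<m}"
  then show "P $$ (i, p i) \<in> mpolys n"
    using permutes_in_image[of p "{0..<m}" i] by (intro entries) auto
qed (auto simp: sign_def mpolys_1 mpolys_uminus)

section \<open>The pencil and its determinant\<close>

lemma finsum_module_mat:
  fixes X :: "'i \<Rightarrow> 'a::comm_ring_1 mat"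
  assumes "finite I" "\<And>k. k \<in> I \<Longrightarrow> X k \<in> carrier_mat nr nc"
  shows "finsum (module_mat TYPE('a) nr nc) X I = mat nr nc (\<lambda>(i, j). \<Sum>k\<in>I. X k $$ (i, j))"
proof -
  interpret abelian_group "module_mat TYPE('a) nr nc"
    by (rule abelian_group_mat)
  show ?thesis
    using assms
  proof (induction I rule: finite_induct)
    case empty
    show ?case
      by (auto simp: module_mat_simps)
  next
    case (insert k I)
    then have "finsum (module_mat TYPE('a) nr nc) X (insert k I) =
        X k + finsum (module_mat TYPE('a) nr nc) X I"
      by (subst finsum_insert) (auto simp: module_mat_simps)
    then show ?case
      using insert by auto
  qed
qed

lemma pencil_eq:
  assumes "\<And>k. k < n \<Longrightarrow> A k \<in> carrier_mat m m" "B \<in> carrier_mat m m"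
  shows "pencil m n A B =
    mat m m (\<lambda>(i, j). (\<Sum>k<n. mvar k * mconst (A k $$ (i, j))) + mconst (B $$ (i, j)))"
proof -
  have "(\<Sum>k<n. (mvar k \<cdot>\<^sub>m map_mat mconst (A k)) $$ (i, j)) = (\<Sum>k<n. mvar k * mconst (A k $$ (i, j)))"
    if "i < m" "j < m" for i j
    using that by (intro sum.cong) (simp_all add: carrier_matD[OF assms(1)])
  then show ?thesis
    unfolding pencil_def using assms
    by (subst finsum_module_mat) (auto intro!: eq_matI)
qed

text \<open>Applying the adjugate to \<open>P *\<^sub>v w\<close> gives
  \<open>det P * w $ k = 0\<close>, and a unit can be cancelled in any commutative ring.\<close>

lemma det_eq_0_of_kernel_unit:
  fixes P :: "'a::comm_ring_1 mat"
  assumes P: "P \<in> carrier_mat m m" and w: "w \<in> carrier_vec m" and "P *\<^sub>v w = 0\<^sub>v m"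
    and k: "k < m" "w $ k dvd 1"
  shows "det P = 0"
proof -
  have "det P \<cdot>\<^sub>v w = adj_mat P *\<^sub>v (P *\<^sub>v w)"
    by (rule adj_mat_mult_mat_vec[OF P w, symmetric])
  also have "\<dots> = 0\<^sub>v m"
    using adj_mat(1)[OF P] assms(3) by auto
  finally have "det P * w $ k = 0"
    using k w by (metis carrier_vecD index_smult_vec(1) index_zero_vec(1))
  moreover obtain c where "w $ k * c = 1"
    using k(2) by (metis dvdE)
  ultimately show ?thesis
    by (metis mult.assoc mult_1_right mult_zero_left)
qed

lemma lookup_det_pencil_real:
  assumes A: "\<And>k. k < n \<Longrightarrow> hermitian_mat m (A k)" and B: "hermitian_mat m B"
  shows "Poly_Mapping.lookup (det (pencil m n A B)) \<alpha> \<in> \<real>"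
proof -
  interpret comm_ring_hom cnj_mpoly
    by (rule comm_ring_hom_cnj_mpoly)
  let ?P = "pencil m n A B"
  have carrier: "A k \<in> carrier_mat m m" if "k < n" for k
    using A[OF that] by (simp add: hermitian_mat_def)
  have B_carrier: "B \<in> carrier_mat m m"
    using B by (simp add: hermitian_mat_def)
  note P = pencil_eq[where A = A, OF carrier B_carrier]
  have P_carrier: "?P \<in> carrier_mat m m"
    by (simp add: P)
  have cnj_mvar: "cnj_mpoly (mvar k) = mvar k" for k
    by (simp add: mvar_def cnj_mpoly_single)
  have cnj_mconst: "cnj_mpoly (mconst c) = mconst (cnj c)" for c
    by (simp add: mconst_def cnj_mpoly_single)
  \<comment> \<open>Conjugation fixes each \<open>mvar k\<close> and transposes each Hermitian
    coefficient matrix; \<open>det\<close> does not see the transposition.\<close>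
  have "map_mat cnj_mpoly ?P = transpose_mat ?P"
  proof (rule eq_matI)
    fix i j assume "i < dim_row (transpose_mat ?P)" "j < dim_col (transpose_mat ?P)"
    then have ij: "i < m" "j < m"
      using P_carrier by auto
    have "cnj (A k $$ (i, j)) = A k $$ (j, i)" if "k < n" for k
      using hermitian_mat_herm[OF A[OF that]] ij by (simp add: herm_def)
    moreover have "cnj (B $$ (i, j)) = B $$ (j, i)"
      using hermitian_mat_herm[OF B] ij by (simp add: herm_def)
    ultimately show "map_mat cnj_mpoly ?P $$ (i, j) = transpose_mat ?P $$ (i, j)"
      using ij by (simp add: P hom_distribs cnj_mvar cnj_mconst)
  qed (use P_carrier in auto)
  then have "cnj_mpoly (det ?P) = det ?P"
    using hom_det[of ?P] det_transpose[OF P_carrier] by simp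
  then have "cnj (Poly_Mapping.lookup (det ?P) \<alpha>) = Poly_Mapping.lookup (det ?P) \<alpha>"
    by (metis lookup_cnj_mpoly)
  then show ?thesis
    by (simp add: Reals_cnj_iff)
qed

section \<open>The common kernel and real stability\<close>

text \<open>Used twice: with complex scalars \<open>z k\<close> for the evaluated matrix, and with
  \<open>mvar k\<close> for the pencil itself.\<close>

lemma app_lincomb:
  "app m (\<lambda>i j. (\<Sum>k\<in>I. c k * a k i j) + b i j) v i = (\<Sum>k\<in>I. c k * app m (a k) v i) + app m b v i"
proof -
  have "app m (\<lambda>i j. (\<Sum>k\<in>I. c k * a k i j) + b i j) v i =
      (\<Sum>j<m. \<Sum>k\<in>I. c k * (a k i j * v j)) + app m b v i"
    by (simp add: app_def distrib_right sum_distrib_right sum.distrib mult.assoc)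
  also have "(\<Sum>j<m. \<Sum>k\<in>I. c k * (a k i j * v j)) = (\<Sum>k\<in>I. c k * app m (a k) v i)"
    by (subst sum.swap) (simp add: app_def sum_distrib_left)
  finally show ?thesis .
qed

lemma common_kernel:
  fixes n :: nat
  assumes A: "\<And>k. k < n \<Longrightarrow> psd_mat m (A k)" and B: "hermitian_mat m B"
    and z: "\<And>k. k < n \<Longrightarrow> 0 < Im (z k)"
    and zero: "\<And>i. i < m \<Longrightarrow>
      (\<Sum>k<n. z k * app m (entries (A k)) v i) + app m (entries B) v i = 0"
    and "i < m"
  shows "k < n \<Longrightarrow> app m (entries (A k)) v i = 0" "app m (entries B) v i = 0"
proof -
  have hermA: "herm m (entries (A k))" if "k < n" for k
    using A[OF that] hermitian_mat_herm by (auto simp: psd_mat_def)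
  have "0 = sesq m v (\<lambda>i. (\<Sum>k<n. z k * app m (entries (A k)) v i) + app m (entries B) v i)"
    by (simp add: sesq_def zero)
  also have "\<dots> = (\<Sum>i<m. \<Sum>k<n. z k * (cnj (v i) * app m (entries (A k)) v i)) + sesq m v (app m (entries B) v)"
    by (simp add: sesq_def distrib_left sum.distrib sum_distrib_left mult.left_commute)
  also have "(\<Sum>i<m. \<Sum>k<n. z k * (cnj (v i) * app m (entries (A k)) v i)) =
      (\<Sum>k<n. z k * sesq m v (app m (entries (A k)) v))"
    by (subst sum.swap) (simp add: sesq_def sum_distrib_left)
  also have "\<dots> = (\<Sum>k<n. z k * of_real (qform m (entries (A k)) v))"
    by (intro sum.cong) (simp_all add: sesq_app_self_real[OF hermA])
  also have "sesq m v (app m (entries B) v) = of_real (qform m (entries B) v)"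
    by (rule sesq_app_self_real[OF hermitian_mat_herm[OF B]])
  \<comment> \<open>All the forms are real: \<open>B\<close> drops out of the imaginary part, and
    \<open>z k\<close> enters only through \<open>Im (z k)\<close>.\<close>
  finally have "Im ((\<Sum>k<n. z k * of_real (qform m (entries (A k)) v)) + of_real (qform m (entries B) v)) = 0"
    by (metis zero_complex.simps(2))
  then have "(\<Sum>k<n. Im (z k) * qform m (entries (A k)) v) = 0"
    by simp
  moreover have "0 \<le> Im (z k) * qform m (entries (A k)) v" if "k < n" for k
    using z[OF that] psd_mat_qform_nonneg[OF A[OF that]] by simp
  ultimately have "Im (z k) * qform m (entries (A k)) v = 0" if "k < n" for k
    using that by (subst (asm) sum_nonneg_eq_0_iff) auto
  then have "qform m (entries (A k)) v = 0" if "k < n" for k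
    using z[OF that] that by fastforce
  then have *: "app m (entries (A k)) v i = 0" if "k < n" for k
    using psd_mat_app_eq_0[OF A[OF that]] \<open>i < m\<close> that by blast
  then show "k < n \<Longrightarrow> app m (entries (A k)) v i = 0" .
  show "app m (entries B) v i = 0"
    using zero[OF \<open>i < m\<close>] * by simp
qed

theorem proposition1p12:
  fixes m n :: nat and A :: "nat \<Rightarrow> complex mat" and B :: "complex mat"
  assumes "\<And>i. i < n \<Longrightarrow> psd_mat m (A i)"
    and "hermitian_mat m B"
  shows "real_stable n (det (pencil m n A B)) \<or> det (pencil m n A B) = 0"
proof (cases "det (pencil m n A B) = 0")
  case False
  let ?P = "pencil m n A B"
  have herm: "hermitian_mat m (A k)" if "k < n" for k
    using assms(1)[OF that] by (simp add: psd_mat_def)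
  have carrier: "A k \<in> carrier_mat m m" if "k < n" for k
    using herm[OF that] by (simp add: hermitian_mat_def)
  have B_carrier: "B \<in> carrier_mat m m"
    using assms(2) by (simp add: hermitian_mat_def)
  note P = pencil_eq[where A = A, OF carrier B_carrier]
  have P_carrier: "?P \<in> carrier_mat m m"
    by (simp add: P)
  have "det ?P \<in> mpolys n"
    by (rule mpolys_det[OF P_carrier])
      (auto simp: P intro!: mpolys_add mpolys_sum mpolys_mult mpolys_mvar mpolys_mconst)
  moreover have "eval_mpoly (det ?P) z \<noteq> 0" if z: "\<forall>j<n. 0 < Im (z j)" for z
  proof
    interpret eval: comm_ring_hom "\<lambda>f. eval_mpoly f z"
      by (rule comm_ring_hom_eval_mpoly)
    let ?M = "map_mat (\<lambda>f. eval_mpoly f z) ?P"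
    assume "eval_mpoly (det ?P) z = 0"
    then have "det ?M = 0"
      by simp
    moreover have M_carrier: "?M \<in> carrier_mat m m"
      using P_carrier by simp
    ultimately obtain v where v: "v \<in> carrier_vec m" "v \<noteq> 0\<^sub>v m"
        and Mv: "\<And>i. i < m \<Longrightarrow> app m (entries ?M) (($) v) i = 0"
      using singular_mat_app by blast
    have "app m (entries ?M) (($) v) i =
        (\<Sum>k<n. z k * app m (entries (A k)) (($) v) i) + app m (entries B) (($) v) i" if "i < m" for i
    proof -
      have "app m (entries ?M) (($) v) i =
          app m (\<lambda>i j. (\<Sum>k<n. z k * A k $$ (i, j)) + B $$ (i, j)) (($) v) i"
        unfolding app_def using that by (intro sum.cong refl) (simp add: P hom_distribs)
      then show ?thesis
        by (simp add: app_lincomb)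
    qed
    then have zero: "(\<Sum>k<n. z k * app m (entries (A k)) (($) v) i) + app m (entries B) (($) v) i = 0"
      if "i < m" for i
      using Mv that by simp
    note kernel = common_kernel[where A = A and z = z, OF assms z[rule_format] zero]
    interpret const: comm_ring_hom mconst
      by (rule comm_ring_hom_mconst)
    \<comment> \<open>The kernel found at the single point \<open>z\<close> lies in the kernel of
      every coefficient matrix, so it can be read as a vector of constant polynomials.\<close>
    let ?w = "map_vec mconst v"
    have w: "?w \<in> carrier_vec m"
      using v by simp
    have app_const: "app m (\<lambda>i j. mconst (X $$ (i, j))) (\<lambda>j. mconst (v $ j)) i =
        mconst (app m (entries X) (($) v) i)" for X i
      by (simp add: app_def hom_distribs)
    have "?P *\<^sub>v ?w = 0\<^sub>v m"
    proof (rule eq_vecI)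
      fix i assume "i < dim_vec (0\<^sub>v m)"
      then have i: "i < m"
        by simp
      have "(?P *\<^sub>v ?w) $ i = app m (entries ?P) (($) ?w) i"
        by (rule index_mult_mat_vec_app[OF P_carrier w i])
      also have "\<dots> = app m (\<lambda>i j. (\<Sum>k<n. mvar k * mconst (A k $$ (i, j))) + mconst (B $$ (i, j)))
          (\<lambda>j. mconst (v $ j)) i"
        unfolding app_def using i v by (intro sum.cong refl) (simp add: P)
      also have "\<dots> = 0"
        unfolding app_lincomb app_const using kernel i by simp
      finally show "(?P *\<^sub>v ?w) $ i = 0\<^sub>v m $ i"
        using i by simp
    qed (use P_carrier in simp)
    moreover obtain k where k: "k < m" "v $ k \<noteq> 0"
      using v by (metis carrier_vecD eq_vecI index_zero_vec)
    \<comment> \<open>A nonzero complex constant remains a unit in the polynomial ring.\<close>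
    moreover have "?w $ k dvd 1"
      using k v const.hom_dvd[of "v $ k" 1] by (simp add: dvd_field_iff)
    ultimately have "det ?P = 0"
      using v by (intro det_eq_0_of_kernel_unit[OF P_carrier, of ?w]) auto
    then show False
      using False by simp
  qed
  ultimately show ?thesis
    using lookup_det_pencil_real[where A = A, OF herm assms(2)] by (simp add: real_stable_def)
qed simp

end
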